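(* Let $\mathbf{B}=\langle B,\oplus,{}',0\rangle$ be a basic algebra. Define, for $x,y\in B$, $x+y=(x'\oplus y)'\oplus y$, $x\cdot y=(x'\oplus y')'$, $\alpha(x)=x'$, and $1=0'$. Then the structure $\mathbf{R}(\mathbf{B})=\langle B,+,\cdot,\alpha,0,1\rangle$ is a Łukasiewicz near semiring.
   Context: A basic algebra is an algebra $\langle A,\oplus,{}',0\rangle$ of type $\langle 2,1,0\rangle$ satisfying, with $1:=0'$: (BA1) $x\oplus 0=x$; (BA2) $x''=x$; (BA3) $(x'\oplus y)'\oplus y=(y'\oplus x)'\oplus x$; (BA4) $(((x\oplus y)'\oplus y)'\oplus z)'\oplus(x\oplus z)=1$. A near semiring is an algebra $\langle R,+,\cdot,0,1\rangle$ such that: (i) $\langle R,+,0\rangle$ is a commutative monoid; (ii) $x\cdot 1=x=1\cdot x$ (multiplication need not be associative or commutative); (iii) $(x+y)\cdot z=(x\cdot z)+(y\cdot z)$; (iv) $x\cdot 0=0\cdot x=0$. It is idempotent if $x+x=x$; then $x\le y$ iff $x+y=y$ defines a partial order, called the induced order. An involutive near semiring is an idempotent near semiring with a map $\alpha:R\to R$ such that $\alpha(\alpha(x))=x$, and $x\le y$ implies $\alpha(y)\le\alpha(x)$. A Łukasiewicz near semiring is an involutive near semiring satisfying the identity $\alpha(x\cdot\alpha(y))\cdot\alpha(y)=\alpha(y\cdot\alpha(x))\cdot\alpha(x)$. *)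

theory Defs
  imports "HOL-Algebra.Ring"
begin

record 'a basic_alg = "'a partial_object" +
  bplus :: "'a \<Rightarrow> 'a \<Rightarrow> 'a" (infixl "\<boxplus>\<index>" 65)
  bneg :: "'a \<Rightarrow> 'a" ("\<sim>\<index> _" [81] 80)
  bzero :: 'a ("\<^bold>0\<index>")

definition bone :: "('a, 'm) basic_alg_scheme \<Rightarrow> 'a" ("\<^bold>1\<index>")
  where "\<^bold>1\<^bsub>B\<^esub> = \<sim>\<^bsub>B\<^esub> \<^bold>0\<^bsub>B\<^esub>"

locale basic_algebra =
  fixes B (structure)
  assumes bplus_closed: "\<lbrakk>x \<in> carrier B; y \<in> carrier B\<rbrakk> \<Longrightarrow> x \<boxplus> y \<in> carrier B"
    and bneg_closed: "x \<in> carrier B \<Longrightarrow> \<sim> x \<in> carrier B"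
    and bzero_closed: "\<^bold>0 \<in> carrier B"
    and BA1: "x \<in> carrier B \<Longrightarrow> x \<boxplus> \<^bold>0 = x"
    and BA2: "x \<in> carrier B \<Longrightarrow> \<sim> (\<sim> x) = x"
    and BA3: "\<lbrakk>x \<in> carrier B; y \<in> carrier B\<rbrakk> \<Longrightarrow>
      \<sim> (\<sim> x \<boxplus> y) \<boxplus> y = \<sim> (\<sim> y \<boxplus> x) \<boxplus> x"
    and BA4: "\<lbrakk>x \<in> carrier B; y \<in> carrier B; z \<in> carrier B\<rbrakk> \<Longrightarrow>
      \<sim> (\<sim> (\<sim> (x \<boxplus> y) \<boxplus> y) \<boxplus> z) \<boxplus> (x \<boxplus> z) = \<^bold>1"

text \<open>Despite its name, \<^locale>\<open>abelian_monoid\<close> does not constrain multiplication, so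
  multiplication is not assumed to be associative or commutative here.\<close>

locale near_semiring = abelian_monoid R for R (structure) +
  assumes mult_closed: "\<lbrakk>x \<in> carrier R; y \<in> carrier R\<rbrakk> \<Longrightarrow> x \<otimes> y \<in> carrier R"
    and unit_closed: "\<one> \<in> carrier R"
    and mult_unit_right: "x \<in> carrier R \<Longrightarrow> x \<otimes> \<one> = x"
    and mult_unit_left: "x \<in> carrier R \<Longrightarrow> \<one> \<otimes> x = x"
    and right_distrib: "\<lbrakk>x \<in> carrier R; y \<in> carrier R; z \<in> carrier R\<rbrakk> \<Longrightarrow>
      (x \<oplus> y) \<otimes> z = (x \<otimes> z) \<oplus> (y \<otimes> z)"
    and mult_zero_right: "x \<in> carrier R \<Longrightarrow> x \<otimes> \<zero> = \<zero>"
    and mult_zero_left: "x \<in> carrier R \<Longrightarrow> \<zero> \<otimes> x = \<zero>"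

locale idempotent_near_semiring = near_semiring R for R (structure) +
  assumes add_idem: "x \<in> carrier R \<Longrightarrow> x \<oplus> x = x"

definition induced_le :: "('a, 'm) ring_scheme \<Rightarrow> 'a \<Rightarrow> 'a \<Rightarrow> bool" (infix "\<preceq>\<index>" 50)
  where "x \<preceq>\<^bsub>R\<^esub> y \<longleftrightarrow> x \<oplus>\<^bsub>R\<^esub> y = y"

record 'a ring_with_involution = "'a ring" +
  invol :: "'a \<Rightarrow> 'a" ("\<alpha>\<index>")

locale involutive_near_semiring = idempotent_near_semiring R
  for R :: "('a, 'm) ring_with_involution_scheme" (structure) +
  assumes invol_closed: "x \<in> carrier R \<Longrightarrow> \<alpha> x \<in> carrier R"
    and invol_invol: "x \<in> carrier R \<Longrightarrow> \<alpha> (\<alpha> x) = x"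
    and invol_antitone: "\<lbrakk>x \<in> carrier R; y \<in> carrier R; x \<preceq> y\<rbrakk> \<Longrightarrow> \<alpha> y \<preceq> \<alpha> x"

locale lukasiewicz_near_semiring = involutive_near_semiring R for R (structure) +
  assumes lukasiewicz: "\<lbrakk>x \<in> carrier R; y \<in> carrier R\<rbrakk> \<Longrightarrow>
    \<alpha> (x \<otimes> \<alpha> y) \<otimes> \<alpha> y = \<alpha> (y \<otimes> \<alpha> x) \<otimes> \<alpha> x"

definition near_semiring_of :: "('a, 'm) basic_alg_scheme \<Rightarrow> 'a ring_with_involution"
  where "near_semiring_of B =
    \<lparr>carrier = carrier B,
     mult = (\<lambda>x y. \<sim>\<^bsub>B\<^esub> (\<sim>\<^bsub>B\<^esub> x \<boxplus>\<^bsub>B\<^esub> \<sim>\<^bsub>B\<^esub> y)),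
     one = \<^bold>1\<^bsub>B\<^esub>,
     zero = \<^bold>0\<^bsub>B\<^esub>,
     add = (\<lambda>x y. \<sim>\<^bsub>B\<^esub> (\<sim>\<^bsub>B\<^esub> x \<boxplus>\<^bsub>B\<^esub> y) \<boxplus>\<^bsub>B\<^esub> y),
     invol = (\<lambda>x. \<sim>\<^bsub>B\<^esub> x)\<rparr>"

end

(* Write x \<rightarrow> y for x' \<oplus> y. Then x + y = (x \<rightarrow> y) \<rightarrow> y, and BA4 gives y \<rightarrow> z \<le> x \<rightarrow> z
   whenever x \<le> y, where x \<le> y stands for x \<rightarrow> y = 1. It follows that \<le> is a partial order with
   binary suprema given by +, which makes + associative and idempotent. Since moreover
   x \<le> (x \<rightarrow> z) \<rightarrow> z, the map _ \<rightarrow> z is an antitone Galois connection with itself, hence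
   turns joins into meets; complementing, x \<cdot> z = (x \<rightarrow> z')' preserves joins in x, which is the
   distributive law. The Lukasiewicz identity is BA3 up to double complements. *)
theory Submission
  imports Defs
begin

context basic_algebra
begin

definition imp :: "'a \<Rightarrow> 'a \<Rightarrow> 'a" (infixr "\<rightharpoonup>" 60)
  where "x \<rightharpoonup> y = \<sim> x \<boxplus> y"

definition join :: "'a \<Rightarrow> 'a \<Rightarrow> 'a" (infixl "\<squnion>" 65)
  where "x \<squnion> y = (x \<rightharpoonup> y) \<rightharpoonup> y"

definition le :: "'a \<Rightarrow> 'a \<Rightarrow> bool" (infix "\<sqsubseteq>" 50)
  where "x \<sqsubseteq> y \<longleftrightarrow> x \<rightharpoonup> y = \<^bold>1"

lemma bone_closed: "\<^bold>1 \<in> carrier B"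
  by (simp add: bone_def bneg_closed bzero_closed)

lemma imp_closed: "\<lbrakk>x \<in> carrier B; y \<in> carrier B\<rbrakk> \<Longrightarrow> x \<rightharpoonup> y \<in> carrier B"
  by (simp add: imp_def bplus_closed bneg_closed)

lemma join_closed: "\<lbrakk>x \<in> carrier B; y \<in> carrier B\<rbrakk> \<Longrightarrow> x \<squnion> y \<in> carrier B"
  by (simp add: join_def imp_closed)

lemmas closed = bone_closed imp_closed join_closed bneg_closed bzero_closed bplus_closed

lemma bneg_bone: "\<sim> \<^bold>1 = \<^bold>0"
  by (simp add: bone_def BA2 bzero_closed)

lemma imp_zero: "x \<in> carrier B \<Longrightarrow> x \<rightharpoonup> \<^bold>0 = \<sim> x"
  by (simp add: imp_def BA1 closed)

lemma join_commute: "\<lbrakk>x \<in> carrier B; y \<in> carrier B\<rbrakk> \<Longrightarrow> x \<squnion> y = y \<squnion> x"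
  using BA3 by (simp add: join_def imp_def)

lemma join_zero: "x \<in> carrier B \<Longrightarrow> x \<squnion> \<^bold>0 = x"
  by (simp add: join_def imp_zero closed BA2)

text \<open>This is \<open>BA4\<close> at \<open>\<sim> x\<close>, \<open>y\<close>,
  \<open>z\<close>, read through \<open>\<rightharpoonup>\<close>; the order theory below grows out
  of its instances.\<close>

lemma join_imp_le_imp:
  "\<lbrakk>x \<in> carrier B; y \<in> carrier B; z \<in> carrier B\<rbrakk> \<Longrightarrow> (x \<squnion> y) \<rightharpoonup> z \<sqsubseteq> x \<rightharpoonup> z"
  using BA4[of "\<sim> x" y z] by (simp add: join_def imp_def le_def closed)

lemma le_refl: "x \<in> carrier B \<Longrightarrow> x \<sqsubseteq> x"
  \<comment> \<open>Both joining with zero and implying zero simplify away, so each side of this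
    instance becomes \<open>\<sim> (\<sim> x)\<close>, which is \<open>x\<close>.\<close>
  using join_imp_le_imp[of "\<sim> x" "\<^bold>0" "\<^bold>0"]
  by (simp add: join_zero imp_zero closed BA2)

text \<open>Implying zero is complementation. This form serves to reach \<open>zero_le\<close> from
  a join equal to one, and later yields the upper bound property of
  \<open>\<squnion>\<close>.\<close>

lemma bneg_join_le:
  assumes "x \<in> carrier B" "y \<in> carrier B"
  shows "\<sim> (x \<squnion> y) \<sqsubseteq> \<sim> x"
  using join_imp_le_imp[of x y "\<^bold>0"] assms by (simp add: imp_zero closed)

(* With w = 0 \<rightarrow> y we have w \<rightarrow> y = 0 + y = y, so y + w = w + y = y \<rightarrow> y = 1. *)
lemma zero_le:
  assumes x: "x \<in> carrier B"
  shows "\<^bold>0 \<sqsubseteq> x"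
proof -
  define y where "y = \<sim> x"
  define w where "w = \<^bold>0 \<rightharpoonup> y"
  have y: "y \<in> carrier B" and w: "w \<in> carrier B"
    by (simp_all add: y_def w_def x closed)
  have "w \<rightharpoonup> y = y"
    using join_commute[of "\<^bold>0" y] y by (simp add: w_def closed join_zero flip: join_def)
  then have "w \<squnion> y = \<^bold>1"
    using le_refl[OF y] by (simp add: join_def le_def)
  then have "y \<squnion> w = \<^bold>1"
    using join_commute y w by simp
  then show ?thesis
    using bneg_join_le[OF y w] x by (simp add: bneg_bone y_def BA2)
qed

text \<open>Since zero implies \<open>x\<close> with value one, the left side is the join of zero
  with \<open>x\<close>, which commutes to \<open>x\<close>.\<close>

lemma one_imp: "x \<in> carrier B \<Longrightarrow> \<^bold>1 \<rightharpoonup> x = x"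
  using zero_le[of x] join_commute[of "\<^bold>0" x] join_zero[of x] by (simp add: join_def le_def closed)

lemma le_one:
  assumes x: "x \<in> carrier B"
  shows "x \<sqsubseteq> \<^bold>1"
proof -
  have "x \<squnion> \<^bold>1 = \<^bold>1"
    using join_commute[of x "\<^bold>1"] le_refl[OF x] x
    by (simp add: closed) (simp add: join_def one_imp le_def)
  \<comment> \<open>With both other arguments one, the instance says that one lies below
    \<open>x \<rightharpoonup> z\<close> for \<open>z\<close> equal to one; \<open>one_imp\<close>
    turns this into an equality.\<close>
  then show ?thesis
    using join_imp_le_imp[of x "\<^bold>1" "\<^bold>1"] x by (simp add: le_def closed one_imp)
qed

lemma join_absorb2: "\<lbrakk>x \<in> carrier B; y \<in> carrier B; x \<sqsubseteq> y\<rbrakk> \<Longrightarrow> x \<squnion> y = y"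
  by (simp add: join_def le_def one_imp)

lemma le_antisym: "\<lbrakk>x \<in> carrier B; y \<in> carrier B; x \<sqsubseteq> y; y \<sqsubseteq> x\<rbrakk> \<Longrightarrow> x = y"
  using join_absorb2 join_commute by metis

lemma imp_antimono:
  "\<lbrakk>x \<in> carrier B; y \<in> carrier B; z \<in> carrier B; x \<sqsubseteq> y\<rbrakk> \<Longrightarrow> y \<rightharpoonup> z \<sqsubseteq> x \<rightharpoonup> z"
  using join_imp_le_imp[of x y z] by (simp add: join_absorb2)

text \<open>Here \<open>y \<rightharpoonup> z\<close> is one, so antitonicity puts one below
  \<open>x \<rightharpoonup> z\<close>, and only one lies above one.\<close>

lemma le_trans:
  "\<lbrakk>x \<in> carrier B; y \<in> carrier B; z \<in> carrier B; x \<sqsubseteq> y; y \<sqsubseteq> z\<rbrakk> \<Longrightarrow> x \<sqsubseteq> z"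
  using imp_antimono[of x y z] by (simp add: le_def one_imp closed)

lemma bneg_antimono:
  "\<lbrakk>x \<in> carrier B; y \<in> carrier B; x \<sqsubseteq> y\<rbrakk> \<Longrightarrow> \<sim> y \<sqsubseteq> \<sim> x"
  using imp_antimono[of x y "\<^bold>0"] by (simp add: imp_zero closed)

lemma join_upper1: "\<lbrakk>x \<in> carrier B; y \<in> carrier B\<rbrakk> \<Longrightarrow> x \<sqsubseteq> x \<squnion> y"
  using bneg_antimono[OF _ _ bneg_join_le[of x y]] by (simp add: closed BA2)

lemma join_upper2: "\<lbrakk>x \<in> carrier B; y \<in> carrier B\<rbrakk> \<Longrightarrow> y \<sqsubseteq> x \<squnion> y"
  using join_upper1 join_commute by metis

lemma join_least:
  assumes "x \<in> carrier B" "y \<in> carrier B" "z \<in> carrier B" "x \<sqsubseteq> z" "y \<sqsubseteq> z"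
  shows "x \<squnion> y \<sqsubseteq> z"
proof -
  \<comment> \<open>Two applications of the antitone map \<open>_ \<rightharpoonup> y\<close> make
    \<open>_ \<squnion> y\<close> monotone.\<close>
  have "x \<squnion> y \<sqsubseteq> z \<squnion> y"
    unfolding join_def using assms by (intro imp_antimono closed)
  also have "z \<squnion> y = z"
    using assms join_absorb2 join_commute by metis
  finally show ?thesis .
qed

lemma join_le_iff:
  "\<lbrakk>x \<in> carrier B; y \<in> carrier B; z \<in> carrier B\<rbrakk> \<Longrightarrow> x \<squnion> y \<sqsubseteq> z \<longleftrightarrow> x \<sqsubseteq> z \<and> y \<sqsubseteq> z"
  by (meson join_closed join_least join_upper1 join_upper2 le_trans)

lemma le_iff_join: "\<lbrakk>x \<in> carrier B; y \<in> carrier B\<rbrakk> \<Longrightarrow> x \<sqsubseteq> y \<longleftrightarrow> x \<squnion> y = y"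
  using join_absorb2 join_upper1 by metis

text \<open>Testing against upper bounds reduces identities between joins to
  \<open>join_le_iff\<close>.\<close>

lemma eqI_le_iff:
  assumes "x \<in> carrier B" "y \<in> carrier B" "\<And>z. z \<in> carrier B \<Longrightarrow> x \<sqsubseteq> z \<longleftrightarrow> y \<sqsubseteq> z"
  shows "x = y"
  using assms le_antisym le_refl by metis

lemma join_assoc:
  "\<lbrakk>x \<in> carrier B; y \<in> carrier B; z \<in> carrier B\<rbrakk> \<Longrightarrow> x \<squnion> y \<squnion> z = x \<squnion> (y \<squnion> z)"
  by (rule eqI_le_iff) (simp_all add: closed join_le_iff)

text \<open>Applying \<open>_ \<rightharpoonup> z\<close> to the hypothesis gives \<open>(x
  \<rightharpoonup> z) \<rightharpoonup> z \<sqsubseteq> w \<rightharpoonup> z\<close>, whose left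
  side is \<open>x \<squnion> z\<close>, above \<open>x\<close>.\<close>

lemma le_imp_swap:
  assumes w: "w \<in> carrier B" and x: "x \<in> carrier B" and z: "z \<in> carrier B" and le: "w \<sqsubseteq> x \<rightharpoonup> z"
  shows "x \<sqsubseteq> w \<rightharpoonup> z"
proof -
  have "x \<squnion> z \<sqsubseteq> w \<rightharpoonup> z"
    unfolding join_def using w x z le by (intro imp_antimono closed)
  then show ?thesis
    using w x z by (simp add: join_le_iff closed)
qed

text \<open>Swapping \<open>w\<close> with the join leaves a join on the left, which splits; each
  half is then swapped back.\<close>

lemma le_join_imp_iff:
  assumes "w \<in> carrier B" "x \<in> carrier B" "y \<in> carrier B" "z \<in> carrier B"
  shows "w \<sqsubseteq> (x \<squnion> y) \<rightharpoonup> z \<longleftrightarrow> w \<sqsubseteq> x \<rightharpoonup> z \<and> w \<sqsubseteq> y \<rightharpoonup> z"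
  using assms le_imp_swap by (meson join_closed imp_closed join_le_iff)

lemma bneg_le_iff:
  "\<lbrakk>x \<in> carrier B; y \<in> carrier B\<rbrakk> \<Longrightarrow> \<sim> x \<sqsubseteq> y \<longleftrightarrow> \<sim> y \<sqsubseteq> x"
  using bneg_antimono BA2 bneg_closed by metis

text \<open>Complementing turns the upper bounds of either side into lower bounds of implications,
  where \<open>le_join_imp_iff\<close> applies. At \<open>\<sim> z\<close> this is right
  distributivity.\<close>

lemma bneg_join_imp:
  assumes "x \<in> carrier B" "y \<in> carrier B" "z \<in> carrier B"
  shows "\<sim> ((x \<squnion> y) \<rightharpoonup> z) = \<sim> (x \<rightharpoonup> z) \<squnion> \<sim> (y \<rightharpoonup> z)"
  by (rule eqI_le_iff) (simp_all add: assms closed join_le_iff bneg_le_iff le_join_imp_iff)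

lemma near_semiring_of_simps:
  "carrier (near_semiring_of B) = carrier B"
  "mult (near_semiring_of B) x y = \<sim> (x \<rightharpoonup> \<sim> y)"
  "one (near_semiring_of B) = \<^bold>1"
  "zero (near_semiring_of B) = \<^bold>0"
  "add (near_semiring_of B) x y = x \<squnion> y"
  "invol (near_semiring_of B) x = \<sim> x"
  by (simp_all add: near_semiring_of_def imp_def join_def)

lemma lukasiewicz_near_semiring_of: "lukasiewicz_near_semiring (near_semiring_of B)"
proof -
  interpret R: abelian_monoid "near_semiring_of B"
    by (rule abelian_monoidI)
      (simp_all add: near_semiring_of_simps closed join_assoc join_absorb2 zero_le,
        simp add: join_commute)
  show ?thesis
  proof unfold_locales
    fix x y
    assume "x \<in> carrier (near_semiring_of B)" "y \<in> carrier (near_semiring_of B)"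
    then show "invol (near_semiring_of B) (x \<otimes>\<^bsub>near_semiring_of B\<^esub> invol (near_semiring_of B) y)
          \<otimes>\<^bsub>near_semiring_of B\<^esub> invol (near_semiring_of B) y
        = invol (near_semiring_of B) (y \<otimes>\<^bsub>near_semiring_of B\<^esub> invol (near_semiring_of B) x)
          \<otimes>\<^bsub>near_semiring_of B\<^esub> invol (near_semiring_of B) x"
      \<comment> \<open>After cancelling double complements the two sides are
        \<open>\<sim> (x \<squnion> y)\<close> and \<open>\<sim> (y \<squnion> x)\<close>.\<close>
      using join_commute[of x y]
      by (simp add: near_semiring_of_simps closed BA2 flip: join_def)
  next
    fix x y
    assume "x \<in> carrier (near_semiring_of B)" "y \<in> carrier (near_semiring_of B)"
      and "x \<preceq>\<^bsub>near_semiring_of B\<^esub> y"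
    then show "invol (near_semiring_of B) y \<preceq>\<^bsub>near_semiring_of B\<^esub> invol (near_semiring_of B) x"
      using bneg_antimono by (simp add: near_semiring_of_simps induced_le_def closed flip: le_iff_join)
  next
    fix x
    assume "x \<in> carrier (near_semiring_of B)"
    then show "\<zero>\<^bsub>near_semiring_of B\<^esub> \<otimes>\<^bsub>near_semiring_of B\<^esub> x = \<zero>\<^bsub>near_semiring_of B\<^esub>"
      using zero_le[of "\<sim> x"] by (simp add: near_semiring_of_simps closed le_def bneg_bone)
  next
    fix x
    assume "x \<in> carrier (near_semiring_of B)"
    then show "x \<otimes>\<^bsub>near_semiring_of B\<^esub> \<zero>\<^bsub>near_semiring_of B\<^esub> = \<zero>\<^bsub>near_semiring_of B\<^esub>"
      using le_one[of x] by (simp add: near_semiring_of_simps le_def bneg_bone flip: bone_def)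
  qed (simp_all add: near_semiring_of_simps closed BA2 bneg_bone imp_zero one_imp
      bneg_join_imp join_absorb2 le_refl)
qed

end

theorem theorem5:
  fixes B :: "'a basic_alg"
  assumes "basic_algebra B"
  shows "lukasiewicz_near_semiring (near_semiring_of B)"
  using assms by (rule basic_algebra.lukasiewicz_near_semiring_of)

end
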